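(* Let $v$ be a valuation on a division ring $D$ such that $\overline{D}=\overline{Z(D)}$. If the value group has rational rank one, then $v$ is strongly abelian, i.e. $v(ab-ba)>v(ab)$ for all nonzero $a,b\in D$.
   Context: A valuation on a division ring $D$ is a map $v:D\to\Gamma\cup\{\infty\}$, with $\Gamma$ an additively written (not necessarily abelian) totally ordered group and $\infty>\gamma$ for all $\gamma\in\Gamma$, such that $v(a)=\infty\iff a=0$, $v(ab)=v(a)+v(b)$ and $v(a+b)\ge\min\{v(a),v(b)\}$; the value group is $v(D\setminus\{0\})$. Put $\mathcal{O}_v=\{a\in D: v(a)\ge 0\}$ and $\mathcal{M}_v=\{a\in D: v(a)>0\}$; $\overline{D}=\mathcal{O}_v/\mathcal{M}_v$ is the residue division ring. $Z(D)$ is the center of $D$, and $\overline{Z(D)}$ is the image of $Z(D)\cap\mathcal{O}_v$ in $\overline{D}$. Rational rank one means that any two elements of the value group are rationally dependent (and the group is nontrivial). *)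

theory Defs
  imports Complex_Main "HOL-Algebra.QuotRing"
begin

section \<open>Totally ordered groups, not necessarily abelian\<close>

text \<open>The ordered groups of the library are all abelian, so translation invariance has to be
  required on both sides here.\<close>

class linordered_group = group_add + linorder +
  assumes group_add_left_mono: "a \<le> b \<Longrightarrow> c + a \<le> c + b"
    and group_add_right_mono: "a \<le> b \<Longrightarrow> a + c \<le> b + c"

instance int :: linordered_group
  by standard simp_all

text \<open>The multiple \<open>k \<cdot> g\<close> in an additively written group.\<close>

definition int_multiple :: "int \<Rightarrow> 'g::group_add \<Rightarrow> 'g" where
  "int_multiple k g =
    (if 0 \<le> k then (((+) g) ^^ nat k) 0 else - ((((+) g) ^^ nat (- k)) 0))"

definition rationally_dependent :: "'g::group_add \<Rightarrow> 'g \<Rightarrow> bool" where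
  "rationally_dependent g h \<longleftrightarrow>
    (\<exists>m n. (m, n) \<noteq> (0, 0) \<and> int_multiple m g + int_multiple n h = 0)"

definition rational_rank_one :: "'g::group_add set \<Rightarrow> bool" where
  "rational_rank_one G \<longleftrightarrow>
    G \<noteq> {0} \<and> (\<forall>g\<in>G. \<forall>h\<in>G. rationally_dependent g h)"


section \<open>Adjoining an infinite element\<close>

datatype 'g with_infty = Fin 'g | Infty

instantiation with_infty :: (linorder) linorder
begin

definition less_eq_with_infty :: "'a with_infty \<Rightarrow> 'a with_infty \<Rightarrow> bool" where
  "x \<le> y \<longleftrightarrow>
    (case y of Infty \<Rightarrow> True | Fin h \<Rightarrow> (case x of Infty \<Rightarrow> False | Fin g \<Rightarrow> g \<le> h))"

definition less_with_infty :: "'a with_infty \<Rightarrow> 'a with_infty \<Rightarrow> bool" where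
  "x < y \<longleftrightarrow>
    (case x of Infty \<Rightarrow> False | Fin g \<Rightarrow> (case y of Infty \<Rightarrow> True | Fin h \<Rightarrow> g < h))"

instance
  by standard
    (auto simp: less_eq_with_infty_def less_with_infty_def split: with_infty.splits)

end

instantiation with_infty :: (monoid_add) monoid_add
begin

definition zero_with_infty :: "'a with_infty" where
  "0 = Fin 0"

definition plus_with_infty :: "'a with_infty \<Rightarrow> 'a with_infty \<Rightarrow> 'a with_infty" where
  "x + y = (case x of Infty \<Rightarrow> Infty
    | Fin g \<Rightarrow> (case y of Infty \<Rightarrow> Infty | Fin h \<Rightarrow> Fin (g + h)))"

instance
  by standard
    (auto simp: zero_with_infty_def plus_with_infty_def add.assoc split: with_infty.splits)

end

lemma with_infty_simps [simp]:
  "Fin g \<le> Fin h \<longleftrightarrow> g \<le> h" "x \<le> Infty" "\<not> Infty \<le> Fin g"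
  "Fin g < Fin h \<longleftrightarrow> g < h" "Fin g < Infty" "\<not> Infty < x"
  "Fin a + Fin b = Fin (a + b)" "Infty + y = Infty" "y + Infty = Infty"
  by (auto simp: less_eq_with_infty_def less_with_infty_def plus_with_infty_def
      split: with_infty.splits)


section \<open>Valuations on division rings\<close>

locale valuation =
  fixes v :: "'a::division_ring \<Rightarrow> 'g::linordered_group with_infty"
  assumes eq_Infty_iff: "v a = Infty \<longleftrightarrow> a = 0"
    and mult: "v (a * b) = v a + v b"
    and add: "min (v a) (v b) \<le> v (a + b)"

definition value_group :: "('a::division_ring \<Rightarrow> 'g::linordered_group with_infty) \<Rightarrow> 'g set" where
  "value_group v = {g. Fin g \<in> v ` (UNIV - {0})}"

definition valuation_ring :: "('a::division_ring \<Rightarrow> 'g::linordered_group with_infty) \<Rightarrow> 'a ring" where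
  "valuation_ring v =
    \<lparr>carrier = {a. 0 \<le> v a}, mult = (*), one = 1, zero = 0, add = (+)\<rparr>"

definition maximal_ideal :: "('a::division_ring \<Rightarrow> 'g::linordered_group with_infty) \<Rightarrow> 'a set" where
  "maximal_ideal v = {a. 0 < v a}"

definition residue_division_ring ::
    "('a::division_ring \<Rightarrow> 'g::linordered_group with_infty) \<Rightarrow> 'a set ring" where
  "residue_division_ring v = valuation_ring v Quot maximal_ideal v"

definition residue ::
    "('a::division_ring \<Rightarrow> 'g::linordered_group with_infty) \<Rightarrow> 'a \<Rightarrow> 'a set" where
  "residue v a = maximal_ideal v +>\<^bsub>valuation_ring v\<^esub> a"

definition ring_center :: "'a::ring set" where
  "ring_center = {z. \<forall>a. z * a = a * z}"

definition residue_of_center ::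
    "('a::division_ring \<Rightarrow> 'g::linordered_group with_infty) \<Rightarrow> 'a set set" where
  "residue_of_center v = residue v ` (ring_center \<inter> carrier (valuation_ring v))"

definition strongly_abelian ::
    "('a::division_ring \<Rightarrow> 'g::linordered_group with_infty) \<Rightarrow> bool" where
  "strongly_abelian v \<longleftrightarrow>
    (\<forall>a b. a \<noteq> 0 \<longrightarrow> b \<noteq> 0 \<longrightarrow> v (a * b - b * a) > v (a * b))"


section \<open>The residue ring is well defined\<close>

lemma group_double_eq_0:
  fixes g :: "'g::linordered_group"
  assumes "g + g = 0"
  shows "g = 0"
proof (rule antisym)
  show "g \<le> 0"
  proof (rule ccontr)
    assume "\<not> g \<le> 0"
    hence "0 \<le> g" "g \<noteq> 0" by auto
    with group_add_left_mono[of 0 g g] assms show False by simp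
  qed
  show "0 \<le> g"
  proof (rule ccontr)
    assume "\<not> 0 \<le> g"
    hence "g \<le> 0" "g \<noteq> 0" by auto
    with group_add_left_mono[of g 0 g] assms show False by simp
  qed
qed

lemma with_infty_add_nonneg_pos:
  fixes x y :: "'g::linordered_group with_infty"
  assumes "0 \<le> x" "0 \<le> y"
  shows "0 \<le> x + y" "0 < x \<or> 0 < y \<Longrightarrow> 0 < x + y"
proof -
  have *: "0 \<le> g + h \<and> (0 < g \<or> 0 < h \<longrightarrow> 0 < g + h)" if "0 \<le> g" "0 \<le> h" for g h :: 'g
  proof -
    have 1: "g \<le> g + h" using group_add_left_mono[OF that(2), of g] by simp
    have 2: "h \<le> g + h" using group_add_right_mono[OF that(1), of h] by simp
    show ?thesis using 1 2 that by auto
  qed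
  show "0 \<le> x + y" "0 < x \<or> 0 < y \<Longrightarrow> 0 < x + y"
    using assms * by (cases x; cases y; auto simp: zero_with_infty_def)+
qed

context valuation
begin

lemma zero: "v 0 = Infty"
  by (simp add: eq_Infty_iff)

lemma one: "v 1 = 0"
proof -
  have "v 1 = v 1 + v 1" using mult[of 1 1] by simp
  moreover have "g = 0" if "g = g + g" for g :: 'g
    using that add_left_cancel[of g g 0] by simp
  ultimately show ?thesis using eq_Infty_iff[of 1]
    by (cases "v 1") (auto simp: zero_with_infty_def)
qed

lemma minus: "v (- a) = v a"
proof -
  have "v (- 1) + v (- 1) = 0" using mult[of "- 1" "- 1"] one by simp
  hence "v (- 1) = 0"
    by (cases "v (- 1)") (auto simp: zero_with_infty_def intro: group_double_eq_0)
  thus ?thesis using mult[of "- 1" a] by simp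
qed

lemma add_ge: "c \<le> v a \<Longrightarrow> c \<le> v b \<Longrightarrow> c \<le> v (a + b)"
  using add[of a b] by (auto simp: min_def split: if_splits)

lemma add_gt: "c < v a \<Longrightarrow> c < v b \<Longrightarrow> c < v (a + b)"
  using add[of a b] by (auto simp: min_def split: if_splits)

lemma ring_valuation_ring: "ring (valuation_ring v)"
proof (rule ringI)
  show "abelian_group (valuation_ring v)"
  proof (rule abelian_groupI)
    fix x assume "x \<in> carrier (valuation_ring v)"
    thus "\<exists>y\<in>carrier (valuation_ring v). y \<oplus>\<^bsub>valuation_ring v\<^esub> x = \<zero>\<^bsub>valuation_ring v\<^esub>"
      by (intro bexI[of _ "- x"]) (auto simp: valuation_ring_def minus)
  qed (auto simp: valuation_ring_def add_ge zero algebra_simps)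
  show "Group.monoid (valuation_ring v)"
    by (rule monoidI)
      (auto simp: valuation_ring_def mult one with_infty_add_nonneg_pos mult.assoc)
qed (auto simp: valuation_ring_def algebra_simps)

lemma ideal_maximal_ideal: "ideal (maximal_ideal v) (valuation_ring v)"
proof (rule idealI)
  interpret R: ring "valuation_ring v" by (rule ring_valuation_ring)
  show "ring (valuation_ring v)" by (rule ring_valuation_ring)
  have inv: "inv\<^bsub>add_monoid (valuation_ring v)\<^esub> x = - x" if "x \<in> maximal_ideal v" for x
    using that R.minus_equality[of "- x" x]
    by (auto simp: a_inv_def valuation_ring_def maximal_ideal_def minus)
  show "subgroup (maximal_ideal v) (add_monoid (valuation_ring v))"
  proof (rule subgroup.intro)
    fix x assume "x \<in> maximal_ideal v"
    thus "inv\<^bsub>add_monoid (valuation_ring v)\<^esub> x \<in> maximal_ideal v"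
      by (simp only: inv) (simp add: maximal_ideal_def minus)
  qed (auto simp: valuation_ring_def maximal_ideal_def add_gt zero zero_with_infty_def)
qed (auto simp: valuation_ring_def maximal_ideal_def mult with_infty_add_nonneg_pos)

lemma ring_residue_division_ring: "ring (residue_division_ring v)"
  unfolding residue_division_ring_def
  by (rule ideal.quotient_is_ring[OF ideal_maximal_ideal])

end

end

(* Call nonzero a, b almost commuting if v (a * b - b * a) > v (a * b).  This relation is symmetric.
   Rational rank one makes the value group abelian, because roots in ordered groups are unique;
   hence the elements almost commuting with a fixed b form a subgroup.  It contains b, and also every
   element of value 0, since such an element is central up to an element of positive value.
   If m * v a = n * v b with m <= n, then m * v (a / b) = (n - m) * v b, and a almost commutes with b
   as soon as a / b does: the Euclidean algorithm on (m, n) ends with an element of value 0. *)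

theory Submission
  imports Defs
begin

section \<open>Multiples in ordered groups\<close>

definition nat_multiple :: "nat \<Rightarrow> 'g::group_add \<Rightarrow> 'g" where
  "nat_multiple n g = (((+) g) ^^ n) 0"

lemma nat_multiple_0 [simp]: "nat_multiple 0 g = 0"
  by (simp add: nat_multiple_def)

lemma nat_multiple_Suc [simp]: "nat_multiple (Suc n) g = g + nat_multiple n g"
  by (simp add: nat_multiple_def)

lemma nat_multiple_zero [simp]: "nat_multiple n 0 = 0"
  by (induction n) auto

lemma nat_multiple_add: "nat_multiple (m + n) g = nat_multiple m g + nat_multiple n g"
  by (induction m) (auto simp: add.assoc)

lemma nat_multiple_commutes:
  assumes "g + h = h + g"
  shows "g + nat_multiple n h = nat_multiple n h + g"
proof (induction n)
  case (Suc n)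
  have "g + (h + nat_multiple n h) = h + (g + nat_multiple n h)"
    by (simp only: add.assoc[symmetric] assms)
  with Suc show ?case
    by (simp add: add.assoc)
qed simp

lemma nat_multiple_plus:
  assumes "g + h = h + g"
  shows "nat_multiple n (g + h) = nat_multiple n g + nat_multiple n h"
proof (induction n)
  case (Suc n)
  have "h + nat_multiple n g = nat_multiple n g + h"
    using assms by (intro nat_multiple_commutes) simp
  then have "h + (nat_multiple n g + x) = nat_multiple n g + (h + x)" for x
    by (simp only: add.assoc[symmetric])
  with Suc show ?case
    by (simp add: add.assoc)
qed simp

lemma nat_multiple_uminus: "nat_multiple n (- g) = - nat_multiple n g"
  using nat_multiple_plus[of "- g" g n] by (simp add: eq_neg_iff_add_eq_0)

text \<open>Conjugation by \<open>c\<close> is additive, so it passes through multiples.\<close>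

lemma nat_multiple_conjugate:
  "nat_multiple n (c + g - c) = c + nat_multiple n g - c"
  by (induction n) (auto simp: diff_conv_add_uminus add.assoc simp del: add_uminus_conv_diff)

section \<open>Strict translation invariance and uniqueness of roots\<close>

lemma linordered_group_add_strict_left_mono:
  fixes a b c :: "'g::linordered_group"
  assumes "a < b"
  shows "c + a < c + b"
  using assms group_add_left_mono[of a b c] by (auto simp: less_le)

lemma linordered_group_add_strict_right_mono:
  fixes a b c :: "'g::linordered_group"
  assumes "a < b"
  shows "a + c < b + c"
  using assms group_add_right_mono[of a b c] by (auto simp: less_le)

text \<open>As \<open>g\<close> and \<open>h\<close> may fail to commute, the step uses a left and
  then a right translation: g + n g < g + n h < h + n h.\<close>

lemma nat_multiple_strict_mono:
  fixes g h :: "'g::linordered_group"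
  assumes "g < h" "0 < n"
  shows "nat_multiple n g < nat_multiple n h"
  using \<open>0 < n\<close>
proof (induction n rule: nat_induct_non_zero)
  case (Suc n)
  then show ?case
    using linordered_group_add_strict_left_mono[of "nat_multiple n g" "nat_multiple n h" g]
      linordered_group_add_strict_right_mono[OF \<open>g < h\<close>, of "nat_multiple n h"]
    by simp
qed (use assms in simp)

lemma nat_multiple_eq_iff:
  fixes g h :: "'g::linordered_group"
  assumes "0 < n"
  shows "nat_multiple n g = nat_multiple n h \<longleftrightarrow> g = h"
  using nat_multiple_strict_mono[of g h n] nat_multiple_strict_mono[of h g n] assms
  by (cases g h rule: linorder_cases) auto

lemma nat_multiple_eq_0_iff:
  fixes g :: "'g::linordered_group"
  assumes "0 < n"
  shows "nat_multiple n g = 0 \<longleftrightarrow> g = 0"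
  using nat_multiple_eq_iff[OF assms, of g 0] by simp

text \<open>Since \<open>g\<close> commutes with m g = n h, the conjugate of \<open>h\<close> by
  \<open>g\<close> has the same n-th multiple as \<open>h\<close>; unique roots make it equal to
  \<open>h\<close>.\<close>

lemma commute_if_nat_multiple_eq:
  fixes g h :: "'g::linordered_group"
  assumes eq: "nat_multiple m g = nat_multiple n h" and "(m, n) \<noteq> (0, 0)"
  shows "g + h = h + g"
proof (cases "n = 0")
  case True
  then show ?thesis
    using assms nat_multiple_eq_0_iff[of m g] by simp
next
  case False
  have "nat_multiple n (g + h - g) = g + nat_multiple m g - g"
    by (simp add: nat_multiple_conjugate eq)
  also have "\<dots> = nat_multiple n h"
    using nat_multiple_commutes[of g g m] eq by (simp add: add_diff_eq[symmetric])
  finally have "g + h - g = h"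
    using False by (simp add: nat_multiple_eq_iff)
  then show ?thesis
    by (simp add: diff_eq_eq)
qed

text \<open>One subtraction step of the Euclidean algorithm: for commuting \<open>g\<close> and
  \<open>h\<close>, m (g - h) = m g - m h.\<close>

lemma nat_multiple_diff_eq:
  fixes g h :: "'g::group_add"
  assumes "g + h = h + g" "nat_multiple m g = nat_multiple n h" "m \<le> n"
  shows "nat_multiple m (g - h) = nat_multiple (n - m) h"
proof -
  have "(g - h) + h = h + (g - h)"
    by (simp add: add_diff_eq flip: assms(1))
  then have "nat_multiple m (g - h) + nat_multiple m h = nat_multiple m g"
    using nat_multiple_plus[of "g - h" h m] by simp
  also have "\<dots> = nat_multiple (n - m) h + nat_multiple m h"
    using assms(2,3) by (simp add: nat_multiple_add[symmetric])
  finally show ?thesis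
    by simp
qed

section \<open>Rational dependence with natural coefficients\<close>

lemma int_multiple_eq_nat_multiple:
  obtains g' where "g' \<in> {g, - g}" "int_multiple k g = nat_multiple (nat \<bar>k\<bar>) g'"
  by (cases "0 \<le> k")
    (auto simp: int_multiple_def nat_multiple_uminus nat_multiple_def[symmetric] intro: that)

text \<open>The signs of the integer coefficients are moved into the group elements.\<close>

lemma rationally_dependentE:
  fixes g h :: "'g::group_add"
  assumes "rationally_dependent g h"
  obtains m n g' h' where "(m, n) \<noteq> (0, 0)" "g' \<in> {g, - g}" "h' \<in> {h, - h}"
    "nat_multiple m g' = nat_multiple n h'"
proof -
  obtain k l where kl: "(k, l) \<noteq> (0, 0)" "int_multiple k g + int_multiple l h = 0"
    using assms by (auto simp: rationally_dependent_def)
  obtain g' where g': "g' \<in> {g, - g}" "int_multiple k g = nat_multiple (nat \<bar>k\<bar>) g'"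
    by (rule int_multiple_eq_nat_multiple)
  obtain h' where h': "h' \<in> {h, - h}" "int_multiple l h = nat_multiple (nat \<bar>l\<bar>) h'"
    by (rule int_multiple_eq_nat_multiple)
  \<comment> \<open>Taking the second summand to the other side negates \<open>h'\<close>, which
    stays in \<open>{h, - h}\<close>.\<close>
  have "nat_multiple (nat \<bar>k\<bar>) g' = nat_multiple (nat \<bar>l\<bar>) (- h')"
    using kl(2) by (simp add: g' h' nat_multiple_uminus eq_neg_iff_add_eq_0)
  with kl(1) g'(1) h'(1) show thesis
    by (intro that[of "nat \<bar>k\<bar>" "nat \<bar>l\<bar>" g' "- h'"]) auto
qed

lemma add_commute_uminus_iff:
  fixes g h :: "'g::group_add"
  shows "- g + h = h + - g \<longleftrightarrow> g + h = h + g"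
proof -
  have "- g + h = h + - g \<longleftrightarrow> g + (- g + h) + g = g + (h + - g) + g"
    by (simp only: add_left_cancel add_right_cancel)
  also have "\<dots> \<longleftrightarrow> h + g = g + h"
    by (simp only: add.assoc add.left_inverse add.right_neutral add_minus_cancel)
  finally show ?thesis
    by auto
qed

text \<open>Unique roots give commutation up to signs, and commuting is insensitive to
  signs.\<close>

lemma rationally_dependent_commute:
  fixes g h :: "'g::linordered_group"
  assumes "rationally_dependent g h"
  shows "g + h = h + g"
proof -
  obtain m n g' h' where "(m, n) \<noteq> (0, 0)" "g' \<in> {g, - g}" "h' \<in> {h, - h}"
    "nat_multiple m g' = nat_multiple n h'"
    using assms by (rule rationally_dependentE)
  moreover from this have "g' + h' = h' + g'"
    by (intro commute_if_nat_multiple_eq)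
  ultimately show ?thesis
    using add_commute_uminus_iff[of g h'] add_commute_uminus_iff[of h g] by auto
qed

text \<open>Finiteness of \<open>c\<close> matters: adding \<open>Infty\<close> makes both sides
  equal.\<close>

lemma with_infty_add_strict_left_mono:
  fixes x y c :: "'g::linordered_group with_infty"
  assumes "x < y" "c \<noteq> Infty"
  shows "c + x < c + y"
  using assms linordered_group_add_strict_left_mono by (cases x; cases y; cases c) auto

lemma with_infty_add_strict_right_mono:
  fixes x y c :: "'g::linordered_group with_infty"
  assumes "x < y" "c \<noteq> Infty"
  shows "x + c < y + c"
  using assms linordered_group_add_strict_right_mono by (cases x; cases y; cases c) auto

section \<open>Almost commuting elements\<close>

text \<open>For nonzero \<open>a\<close>, \<open>b\<close> this says that their group commutator is
  1 up to an element of positive value. If a factor is 0, both sides are \<open>Infty\<close> and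
  the relation fails.\<close>

definition almost_commute ::
    "('a::division_ring \<Rightarrow> 'g::linordered_group with_infty) \<Rightarrow> 'a \<Rightarrow> 'a \<Rightarrow> bool" where
  "almost_commute v a b \<longleftrightarrow> v (a * b) < v (a * b - b * a)"

lemma strongly_abelian_iff_almost_commute:
  "strongly_abelian v \<longleftrightarrow> (\<forall>a b. a \<noteq> 0 \<longrightarrow> b \<noteq> 0 \<longrightarrow> almost_commute v a b)"
  by (simp add: strongly_abelian_def almost_commute_def)

context valuation
begin

lemma diff_commute: "v (a - b) = v (b - a)"
  using minus[of "a - b"] by simp

lemma inverse:
  assumes "v a = Fin g"
  shows "v (inverse a) = Fin (- g)"
proof -
  have "a \<noteq> 0"
    using assms eq_Infty_iff[of a] by auto
  then have "v a + v (inverse a) = Fin 0"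
    using mult[of a "inverse a"] one by (simp add: zero_with_infty_def)
  then show ?thesis
    using assms by (cases "v (inverse a)") (auto intro: minus_unique[symmetric])
qed

text \<open>Residues are cosets as sets, and \<open>a\<close> lies in its own coset because 0 is in
  the maximal ideal; hence \<open>a\<close> lies in the coset of \<open>b\<close>.\<close>

lemma residue_eqD:
  assumes "residue v a = residue v b"
  shows "0 < v (a - b)"
proof -
  have "a \<in> residue v a"
    by (auto simp: residue_def a_r_coset_def r_coset_def valuation_ring_def maximal_ideal_def
        zero zero_with_infty_def intro: exI[of _ 0])
  then show ?thesis
    by (auto simp: assms)
      (auto simp: residue_def a_r_coset_def r_coset_def valuation_ring_def maximal_ideal_def)
qed

lemma central_residue_representative:
  assumes "carrier (residue_division_ring v) = residue_of_center v" "0 \<le> v u"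
  obtains z where "z \<in> ring_center" "0 < v (u - z)"
proof -
  have "residue v u \<in> carrier (residue_division_ring v)"
    using assms(2) by (auto simp: residue_division_ring_def FactRing_def A_RCOSETS_def'
        residue_def valuation_ring_def)
  then obtain z where "z \<in> ring_center" "residue v u = residue v z"
    using assms(1) by (auto simp: residue_of_center_def)
  then show thesis
    by (intro that[of z] residue_eqD)
qed

lemma almost_commute_refl:
  assumes "a \<noteq> 0"
  shows "almost_commute v a a"
  using assms eq_Infty_iff[of "a * a"]
  by (cases "v (a * a)") (auto simp: almost_commute_def zero)

end

text \<open>Commuting values will come from rational rank one, central representatives of units from
  the residue hypothesis.\<close>

locale central_residue_valuation = valuation v
  for v :: "'a::division_ring \<Rightarrow> 'g::linordered_group with_infty" +
  assumes value_commute: "v a + v b = v b + v a"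
    and central_residue: "v u = 0 \<Longrightarrow> \<exists>z\<in>ring_center. 0 < v (u - z)"
begin

lemma almost_commute_sym: "almost_commute v a b \<Longrightarrow> almost_commute v b a"
  using diff_commute[of "a * b" "b * a"] by (simp add: almost_commute_def mult value_commute)

text \<open>The difference \<open>a * b * c - c * (a * b)\<close> splits as
  \<open>a * (b * c - c * b) + (a * c - c * a) * b\<close>, and both terms have value above
  \<open>v (a * b * c)\<close>.\<close>

lemma almost_commute_mult:
  assumes "almost_commute v a c" "almost_commute v b c" "a \<noteq> 0" "b \<noteq> 0"
  shows "almost_commute v (a * b) c"
proof -
  have "v (a * b * c) < v (a * (b * c - c * b))"
    using assms with_infty_add_strict_left_mono[of "v (b * c)" "v (b * c - c * b)" "v a"]
    by (simp add: almost_commute_def mult add.assoc eq_Infty_iff)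
  moreover have "v (a * b * c) < v ((a * c - c * a) * b)"
  proof -
    have "v (a * b * c) = v (a * c) + v b"
      by (simp add: mult add.assoc value_commute[of b c])
    then show ?thesis
      using assms with_infty_add_strict_right_mono[of "v (a * c)" "v (a * c - c * a)" "v b"]
      by (simp add: almost_commute_def mult eq_Infty_iff)
  qed
  moreover have "a * b * c - c * (a * b) = a * (b * c - c * b) + (a * c - c * a) * b"
    by (simp add: algebra_simps)
  ultimately show ?thesis
    by (simp add: almost_commute_def add_gt)
qed

text \<open>Multiplying \<open>b * a - a * b\<close> by \<open>inverse a\<close> on both sides turns
  it into \<open>inverse a * b - b * inverse a\<close>.\<close>

lemma almost_commute_inverse:
  assumes "almost_commute v a b" "a \<noteq> 0"
  shows "almost_commute v (inverse a) b"
proof -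
  let ?a = "inverse a"
  have inv: "v ?a \<noteq> Infty"
    using assms(2) by (simp add: eq_Infty_iff)
  have "v (b * a) < v (b * a - a * b)"
    using almost_commute_sym[OF assms(1)] by (simp add: almost_commute_def)
  then have "v (?a * (b * a) * ?a) < v (?a * (b * a - a * b) * ?a)"
    unfolding mult[of "?a * _" ?a] mult[of ?a "_ - _"] mult[of ?a "b * a"]
    by (rule with_infty_add_strict_right_mono[OF
          with_infty_add_strict_left_mono[OF _ inv] inv])
  moreover have "?a * (b * a) * ?a = ?a * b"
    using assms(2) by (simp only: mult.assoc right_inverse mult_1_right simp_thms)
  moreover have "?a * (b * a - a * b) * ?a = ?a * b - b * ?a"
  proof -
    have "?a * (a * b) * ?a = b * ?a"
      using assms(2) by (simp only: mult.assoc[symmetric] left_inverse mult_1_left simp_thms)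
    then show ?thesis
      unfolding right_diff_distrib left_diff_distrib \<open>?a * (b * a) * ?a = ?a * b\<close> by simp
  qed
  ultimately show ?thesis
    by (simp add: almost_commute_def)
qed

text \<open>A central \<open>z\<close> drops out of \<open>u * b - b * u\<close>, so only
  \<open>u - z\<close> contributes, and both of its products with \<open>b\<close> have value above
  \<open>v b\<close>.\<close>

lemma almost_commute_unit:
  assumes "v u = 0" "b \<noteq> 0"
  shows "almost_commute v u b"
proof -
  obtain z where z: "z \<in> ring_center" "0 < v (u - z)"
    using central_residue[OF assms(1)] by blast
  have b: "v b \<noteq> Infty"
    using assms(2) by (simp add: eq_Infty_iff)
  have "v b < v ((u - z) * b)"
    using with_infty_add_strict_right_mono[OF z(2) b] by (simp add: mult)
  moreover have "v b < v (- (b * (u - z)))"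
    using with_infty_add_strict_left_mono[OF z(2) b] by (simp add: minus mult)
  moreover have "z * b = b * z"
    using z(1) by (simp add: ring_center_def)
  then have "u * b - b * u = (u - z) * b + - (b * (u - z))"
    by (simp add: left_diff_distrib right_diff_distrib)
  moreover have "v (u * b) = v b"
    using assms(1) by (simp add: mult)
  ultimately show ?thesis
    by (simp only: almost_commute_def add_gt)
qed

text \<open>The induction on \<open>m + n\<close> is generalized over both elements, since each
  subtraction step replaces one of them by a quotient.\<close>

lemma almost_commute_if_nat_multiple_eq:
  assumes "v a = Fin g" "v b = Fin h" "nat_multiple m g = nat_multiple n h" "(m, n) \<noteq> (0, 0)"
  shows "almost_commute v a b"
  using assms
proof (induction "m + n" arbitrary: m n a b g h rule: less_induct)
  case less
  have nz: "a \<noteq> 0" "b \<noteq> 0"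
    using less.prems(1,2) eq_Infty_iff[of a] eq_Infty_iff[of b] by auto
  have comm: "g + h = h + g"
    using less.prems(3,4) by (rule commute_if_nat_multiple_eq)
  consider "m = 0" | "n = 0" | "0 < m" "m \<le> n" | "0 < n" "n \<le> m"
    by linarith
  then show ?case
  proof cases
    case 1
    then have "v b = 0"
      using less.prems nat_multiple_eq_0_iff[of n h] by (simp add: zero_with_infty_def)
    then show ?thesis
      using nz(1) by (rule almost_commute_sym[OF almost_commute_unit])
  next
    case 2
    then have "v a = 0"
      using less.prems nat_multiple_eq_0_iff[of m g] by (simp add: zero_with_infty_def)
    then show ?thesis
      using nz by (intro almost_commute_unit)
  next
    case 3
    have "v (a * inverse b) = Fin (g - h)"
      using less.prems(1) inverse[OF less.prems(2)] by (simp add: mult)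
    moreover have "nat_multiple m (g - h) = nat_multiple (n - m) h"
      using comm less.prems(3) 3 by (intro nat_multiple_diff_eq)
    \<comment> \<open>As \<open>0 < m\<close>, the sum drops from \<open>m + n\<close> to
      \<open>n\<close>, and the new pair of coefficients is still nonzero.\<close>
    ultimately have "almost_commute v (a * inverse b) b"
      using less.prems(2) 3 by (intro less.hyps[of m "n - m" _ "g - h" _ h]) auto
    \<comment> \<open>Multiplying back by \<open>b\<close> is allowed because \<open>b\<close>
      almost commutes with itself.\<close>
    then have "almost_commute v (a * inverse b * b) b"
      using nz by (intro almost_commute_mult[OF _ almost_commute_refl]) auto
    then show ?thesis
      using nz by (simp add: mult.assoc)
  next
    \<comment> \<open>The previous case with \<open>a\<close> and \<open>b\<close> exchanged;
      symmetry of the relation restores the order.\<close>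
    case 4
    have "v (b * inverse a) = Fin (h - g)"
      using less.prems(2) inverse[OF less.prems(1)] by (simp add: mult)
    moreover have "nat_multiple n (h - g) = nat_multiple (m - n) g"
      using comm[symmetric] less.prems(3)[symmetric] 4 by (intro nat_multiple_diff_eq)
    ultimately have "almost_commute v (b * inverse a) a"
      using less.prems(1) 4 by (intro less.hyps[of n "m - n" _ "h - g" _ g]) auto
    then have "almost_commute v (b * inverse a * a) a"
      using nz by (intro almost_commute_mult[OF _ almost_commute_refl]) auto
    then show ?thesis
      using nz by (simp add: mult.assoc almost_commute_sym)
  qed
qed

lemma almost_commute_inverse_iff:
  assumes "a \<noteq> 0"
  shows "almost_commute v (inverse a) b \<longleftrightarrow> almost_commute v a b"
  using almost_commute_inverse[of a b] almost_commute_inverse[of "inverse a" b] assms by auto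

text \<open>Inverting an element negates its value and preserves almost commuting, so the
  coefficients may be taken natural.\<close>

lemma almost_commute_if_rationally_dependent:
  assumes "v a = Fin g" "v b = Fin h" "rationally_dependent g h"
  shows "almost_commute v a b"
proof -
  have nz: "a \<noteq> 0" "b \<noteq> 0"
    using assms(1,2) eq_Infty_iff[of a] eq_Infty_iff[of b] by auto
  obtain m n g' h' where mn: "(m, n) \<noteq> (0, 0)" "nat_multiple m g' = nat_multiple n h'"
    and g': "g' \<in> {g, - g}" and h': "h' \<in> {h, - h}"
    using assms(3) by (rule rationally_dependentE)
  obtain a' where a': "a' \<in> {a, inverse a}" "v a' = Fin g'"
    using g' assms(1) inverse[OF assms(1)] by blast
  obtain b' where b': "b' \<in> {b, inverse b}" "v b' = Fin h'"
    using h' assms(2) inverse[OF assms(2)] by blast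
  have "almost_commute v a' b'"
    using a'(2) b'(2) mn(2,1) by (rule almost_commute_if_nat_multiple_eq)
  then have "almost_commute v a b'"
    using a'(1) nz by (auto simp: almost_commute_inverse_iff)
  then have "almost_commute v b' a"
    by (rule almost_commute_sym)
  then have "almost_commute v b a"
    using b'(1) nz by (auto simp: almost_commute_inverse_iff)
  then show ?thesis
    by (rule almost_commute_sym)
qed

end

theorem corollary2p4:
  fixes v :: "'a::division_ring \<Rightarrow> 'g::linordered_group with_infty"
  assumes "valuation v"
    and "carrier (residue_division_ring v) = residue_of_center v"
    and "rational_rank_one (value_group v)"
  shows "strongly_abelian v"
proof -
  interpret valuation v by fact
  have dep: "rationally_dependent g h" if "v a = Fin g" "v b = Fin h" for a b g h
  proof -
    have "a \<noteq> 0" "b \<noteq> 0"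
      using that eq_Infty_iff[of a] eq_Infty_iff[of b] by auto
    then have "g \<in> value_group v" "h \<in> value_group v"
      using that[symmetric] by (auto simp: value_group_def)
    then show ?thesis
      using assms(3) by (simp add: rational_rank_one_def)
  qed
  interpret central_residue_valuation v
  proof
    \<comment> \<open>If either value is \<open>Infty\<close>, both sums are
      \<open>Infty\<close>.\<close>
    show "v a + v b = v b + v a" for a b
      using dep[of a _ b] rationally_dependent_commute by (cases "v a"; cases "v b") auto
    show "\<exists>z\<in>ring_center. 0 < v (u - z)" if "v u = 0" for u
      using central_residue_representative[OF assms(2), of u] that by auto
  qed
  have "almost_commute v a b" if "a \<noteq> 0" "b \<noteq> 0" for a b
    using that eq_Infty_iff[of a] eq_Infty_iff[of b] almost_commute_if_rationally_dependent dep
    by (cases "v a"; cases "v b") auto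
  then show ?thesis
    by (simp add: strongly_abelian_iff_almost_commute)
qed

end
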